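(* Let $x$ be a complex number and $n$ a nonnegative integer such that all quantities below are defined. Then \[ \sum_{k=0}^n(-1)^k\binom{n}{k}\frac{\binom{2x+n+k}{k}}{\binom{x+k}{k}}k^2H_{k}=\frac{n(2x+n+1)(n^2+n+2nx-x)}{(x+1)(x+2)} \times\begin{cases} 2H_{2m}-H_m+H_{m-2}(x+2)+\frac{1-x}{2m(2x+2m+1)-x}, & n=2m;\\[1mm] H_m-2H_{2m}-H_{m-1}(x+2)-\frac{x+3}{2m(2x+2m+3)+x+2}, & n=2m+1. \end{cases} \]
   Context: For a complex $y$ and an integer $k\ge 0$, $\binom{y}{k}=\frac{y(y-1)\cdots(y-k+1)}{k!}$. For complex $x$ and integer $n\ge0$, $H_0(x)=0$, $H_n(x)=\sum_{k=1}^n\frac{1}{x+k}$, and $H_n=H_n(0)$. For negative indices the convention $H_{-j}(y)=-\sum_{i=0}^{j-1}\frac{1}{y-i}$ is used, i.e. $H_{-1}(y)=-\frac1y$ and $H_{-2}(y)=-\frac1y-\frac1{y-1}$. *)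

theory Defs
  imports Complex_Main
begin

text \<open>The shifted harmonic number \<open>H_j(y)\<close> for an integer index \<open>j\<close>; the ordinary harmonic
  number \<open>H_n\<close> is \<open>shifted_harm n 0\<close>.\<close>

definition shifted_harm :: "int \<Rightarrow> complex \<Rightarrow> complex" where
  "shifted_harm j y =
     (if 0 \<le> j then (\<Sum>k=1..nat j. 1 / (y + of_nat k))
      else - (\<Sum>i<nat (- j). 1 / (y - of_nat i)))"

text \<open>Division by zero is total in HOL, so the requirement that \<open>H_j(y)\<close> be defined, i.e. that no
  denominator in it vanishes, is a separate predicate.\<close>

definition shifted_harm_defined :: "int \<Rightarrow> complex \<Rightarrow> bool" where
  "shifted_harm_defined j y \<longleftrightarrow>
     (if 0 \<le> j then (\<forall>k\<in>{1..nat j}. y + of_nat k \<noteq> 0)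
      else (\<forall>i<nat (- j). y - of_nat i \<noteq> 0))"

end

theory Submission
  imports Defs "HOL-Computational_Algebra.Formal_Power_Series"
begin

text \<open>
  Let \<open>f(n,k) = (-1)^k C(n,k) (2x+n+1)_k / (x+1)_k\<close> and \<open>P = n(2x+n+1)\<close>. The hypergeometric ratio
  \<open>f(n,k+1)/f(n,k)\<close> gives
  \<open>\<Sum> k(k+x) f(n,k) \<phi>(k) = \<Sum> (k-n)(k+2x+n+1) f(n,k) \<phi>(k+1)\<close> for every \<open>\<phi>\<close>. Taking \<open>\<phi>(k)\<close> to be
  \<open>1\<close>, \<open>k\<close>, \<open>H_k\<close> and \<open>k H_k\<close> cancels the leading powers of \<open>k\<close> and expresses \<open>\<Sum> k^2 f(n,k) H_k\<close>
  through \<open>\<Sum> f(n,k) = (-1)^n\<close> (Chu-Vandermonde) and \<open>A(n) = \<Sum> f(n,k) H_k\<close>. For the latter,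
  \<open>f(n+1,k) + f(n,k)\<close> is a difference in \<open>k\<close>; summation by parts turns \<open>A(n+1) + A(n)\<close> into a sum
  that is again evaluated by Chu-Vandermonde, whence
  \<open>A(n) = (-1)^n (2 H_n - H_m + H_m(x))\<close> with \<open>m = \<lfloor>n/2\<rfloor>\<close>.
\<close>

section \<open>Chu-Vandermonde summation and Pochhammer preliminaries\<close>

text \<open>Each summand is n! times a product of generalised binomials with upper arguments -b and
  c+n-1, so this is Vandermonde's convolution. Keeping the factor (c+k)_(n-k) instead of dividing by
  (c)_k makes the choice c = x below legitimate even when x = 0.\<close>

lemma Chu_Vandermonde_pochhammer:
  fixes b c :: "'a :: field_char_0"
  shows "(\<Sum>k\<le>n. (-1) ^ k * of_nat (n choose k) * pochhammer b k * pochhammer (c + of_nat k) (n - k))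
       = pochhammer (c - b) n"
proof -
  have "(\<Sum>k\<le>n. (-1) ^ k * of_nat (n choose k) * pochhammer b k * pochhammer (c + of_nat k) (n - k))
      = (\<Sum>k\<le>n. fact n * ((- b gchoose k) * ((c + of_nat n - 1) gchoose (n - k))))"
  proof (intro sum.cong refl)
    fix k assume "k \<in> {..n}"
    then have k: "k \<le> n" by simp
    have "c + of_nat n - 1 - of_nat (n - k) + 1 = c + of_nat k"
      using k by (simp add: of_nat_diff)
    then show "(-1) ^ k * of_nat (n choose k) * pochhammer b k * pochhammer (c + of_nat k) (n - k)
        = fact n * ((- b gchoose k) * ((c + of_nat n - 1) gchoose (n - k)))"
      using k by (simp add: gbinomial_pochhammer[of "- b"] gbinomial_pochhammer'[of "c + of_nat n - 1"]
          binomial_fact)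
  qed
  also have "\<dots> = fact n * ((- b + (c + of_nat n - 1)) gchoose n)"
    by (simp add: sum_distrib_left[symmetric] gbinomial_Vandermonde atMost_atLeast0)
  also have "\<dots> = pochhammer (c - b) n"
    by (simp add: gbinomial_pochhammer' algebra_simps)
  finally show ?thesis .
qed

lemma pochhammer_split_nonzero:
  fixes c :: "'a :: field_char_0"
  assumes "pochhammer c n \<noteq> 0" "k \<le> n"
  shows "pochhammer c k \<noteq> 0" "pochhammer (c + of_nat k) (n - k) = pochhammer c n / pochhammer c k"
  using assms pochhammer_product[OF assms(2), of c] by auto

lemma one_plus_of_nat_neq_0: "1 + of_nat k \<noteq> (0 :: 'a :: semiring_char_0)"
  using of_nat_neq_0[of k, where 'a='a] by simp

lemma of_nat_choose_Suc:
  "of_nat (n choose Suc k)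
     = (of_nat n - of_nat k) * of_nat (n choose k) / (1 + of_nat k :: 'a :: field_char_0)"
  using gbinomial_mult_1[of "of_nat n :: 'a" k] one_plus_of_nat_neq_0[of k, where 'a='a]
  by (simp add: binomial_gbinomial nonzero_eq_divide_eq algebra_simps)

section \<open>Hypergeometric coefficients, their term ratio and their sum\<close>

text \<open>Up to normalisation, the coefficients of the Gegenbauer polynomial of degree \<open>n\<close> and
  parameter \<open>x + 1/2\<close> in powers of \<open>(1 - z)/2\<close>.\<close>

definition geg_coeff :: "complex \<Rightarrow> nat \<Rightarrow> nat \<Rightarrow> complex" where
  "geg_coeff x n k =
     (-1) ^ k * of_nat (n choose k) * pochhammer (2 * x + of_nat n + 1) k / pochhammer (x + 1) k"

lemma geg_coeff_0 [simp]: "geg_coeff x n 0 = 1"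
  by (simp add: geg_coeff_def)

lemma geg_coeff_eq_0 [simp]: "n < k \<Longrightarrow> geg_coeff x n k = 0"
  by (simp add: geg_coeff_def)

text \<open>The hypergeometric term ratio with denominators cleared. At k = n the factor k - n
  vanishes, and beyond n both coefficients are zero, so only k < n needs a computation.\<close>

lemma geg_coeff_Suc:
  assumes "pochhammer (x + 1) n \<noteq> 0"
  shows "of_nat (Suc k) * (of_nat (Suc k) + x) * geg_coeff x n (Suc k)
       = (of_nat k - of_nat n) * (of_nat k + 2 * x + of_nat n + 1) * geg_coeff x n k"
proof (cases "k < n")
  case True
  have "pochhammer (x + 1) (Suc k) \<noteq> 0"
    using pochhammer_split_nonzero[OF assms, of "Suc k"] True by simp
  then have nz: "pochhammer (x + 1) k \<noteq> 0" "x + 1 + of_nat k \<noteq> 0"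
    by (auto simp: pochhammer_Suc)
  define B where "B = (of_nat (n choose k) :: complex)"
  show ?thesis
    using nz one_plus_of_nat_neq_0[of k, where 'a=complex]
    unfolding geg_coeff_def of_nat_choose_Suc pochhammer_Suc power_Suc B_def[symmetric]
    by (simp add: divide_simps) algebra
qed (cases "k = n", auto)

text \<open>Chu-Vandermonde with b = 2x+n+1 and c = x+1, where c - b = -(x+n) reflects to (x+1)_n up
  to sign. In Gegenbauer terms this is the value at z = -1, determined by parity.\<close>

lemma sum_geg_coeff:
  assumes "pochhammer (x + 1) n \<noteq> 0"
  shows "(\<Sum>k\<le>n. geg_coeff x n k) = (-1) ^ n"
proof -
  have "pochhammer (x + 1) n * (\<Sum>k\<le>n. geg_coeff x n k)
      = pochhammer (x + 1 - (2 * x + of_nat n + 1)) n"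
    unfolding Chu_Vandermonde_pochhammer[symmetric] sum_distrib_left
    using pochhammer_split_nonzero[OF assms]
    by (intro sum.cong) (auto simp: geg_coeff_def)
  also have "x + 1 - (2 * x + of_nat n + 1) = - (x + of_nat n)"
    by simp
  also have "pochhammer \<dots> n = (-1) ^ n * pochhammer (x + 1) n"
    unfolding pochhammer_minus by simp
  finally show ?thesis
    using assms by simp
qed

text \<open>An index shift: the factor k removes the term k = 0, and the coefficient at n+1 is zero.
  Different choices of \<open>\<phi>\<close> yield all the linear relations used later.\<close>

lemma sum_geg_coeff_shift:
  assumes "pochhammer (x + 1) n \<noteq> 0"
  shows "(\<Sum>k\<le>n. of_nat k * (of_nat k + x) * geg_coeff x n k * \<phi> k)
       = (\<Sum>k\<le>n. (of_nat k - of_nat n) * (of_nat k + 2 * x + of_nat n + 1) * geg_coeff x n k * \<phi> (Suc k))"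
proof -
  have "(\<Sum>k\<le>n. of_nat k * (of_nat k + x) * geg_coeff x n k * \<phi> k)
      = (\<Sum>k\<le>Suc n. of_nat k * (of_nat k + x) * geg_coeff x n k * \<phi> k)"
    by simp
  also have "\<dots> = (\<Sum>k\<le>n. of_nat (Suc k) * (of_nat (Suc k) + x) * geg_coeff x n (Suc k) * \<phi> (Suc k))"
    by (subst sum.atMost_Suc_shift) simp
  finally show ?thesis
    unfolding geg_coeff_Suc[OF assms] .
qed

section \<open>The sums weighted by 1/(k+1)\<close>

text \<open>Absorbing 1/(k+1) into the binomial, and one factor b = 2x+n+1 into the Pochhammer
  symbol, turns the sum into Chu-Vandermonde of order n+1 with c = x, short of its term k = 0. That
  missing term produces the x on the right.\<close>

lemma sum_geg_coeff_div_Suc_mult: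
  fixes x :: complex
  assumes "pochhammer (x + 1) n \<noteq> 0"
  shows "of_nat (Suc n) * (2 * x + of_nat n + 1)
           * (\<Sum>k\<le>n. (-1) ^ k * of_nat (n choose k) * pochhammer (2 * x + of_nat n + 2) k
                / pochhammer (x + 1) k / of_nat (Suc k))
       = x + (-1) ^ n * (x + of_nat n + 1)"
proof -
  define b where "b = 2 * x + of_nat n + 1"
  define N where "N = Suc n"
  let ?t = "\<lambda>k. (-1) ^ k * of_nat (N choose k) * pochhammer b k * pochhammer (x + of_nat k) (N - k)"
  have b1: "b + 1 = 2 * x + of_nat n + 2" by (simp add: b_def)
  have "(\<Sum>k\<le>N. ?t k) = pochhammer (x - b) N"
    by (rule Chu_Vandermonde_pochhammer)
  also have "x - b = - (x + of_nat N)"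
    by (simp add: b_def N_def)
  also have "pochhammer \<dots> N = (-1) ^ N * pochhammer (x + 1) N"
    unfolding pochhammer_minus by simp
  also have "\<dots> = - ((-1) ^ n * (x + of_nat n + 1)) * pochhammer (x + 1) n"
    by (simp add: N_def pochhammer_Suc algebra_simps)
  finally have total: "(\<Sum>k\<le>N. ?t k) = - ((-1) ^ n * (x + of_nat n + 1)) * pochhammer (x + 1) n" .
  have "(\<Sum>k\<le>N. ?t k) = ?t 0 + (\<Sum>k\<le>n. ?t (Suc k))"
    unfolding N_def by (rule sum.atMost_Suc_shift)
  also have "?t 0 = x * pochhammer (x + 1) n"
    by (simp add: N_def pochhammer_rec)
  also have "(\<Sum>k\<le>n. ?t (Suc k)) = (\<Sum>k\<le>n. - (pochhammer (x + 1) n * of_nat N * b) *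
       ((-1) ^ k * of_nat (n choose k) * pochhammer (b + 1) k / pochhammer (x + 1) k / of_nat (Suc k)))"
  proof (intro sum.cong refl)
    fix k assume "k \<in> {..n}"
    then have k: "k \<le> n" by simp
    have C: "of_nat (N choose Suc k) = of_nat N * of_nat (n choose k) / (of_nat (Suc k) :: complex)"
      using Suc_times_binomial_eq[of n k] of_nat_neq_0[of k, where 'a=complex]
      unfolding N_def by (metis nonzero_mult_div_cancel_right of_nat_mult)
    have p: "pochhammer (x + of_nat (Suc k)) (N - Suc k) = pochhammer (x + 1) n / pochhammer (x + 1) k"
      using pochhammer_split_nonzero(2)[OF assms k] by (simp add: N_def add_ac)
    show "?t (Suc k) = - (pochhammer (x + 1) n * of_nat N * b) *
       ((-1) ^ k * of_nat (n choose k) * pochhammer (b + 1) k / pochhammer (x + 1) k / of_nat (Suc k))"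
      unfolding C p pochhammer_rec[of b] by (simp add: mult_ac)
  qed
  finally have "pochhammer (x + 1) n * - ((-1) ^ n * (x + of_nat n + 1))
     = pochhammer (x + 1) n * (x - of_nat N * b * (\<Sum>k\<le>n. (-1) ^ k * of_nat (n choose k)
          * pochhammer (b + 1) k / pochhammer (x + 1) k / of_nat (Suc k)))"
    unfolding total sum_distrib_left[symmetric] by (simp add: algebra_simps)
  then have "- ((-1) ^ n * (x + of_nat n + 1))
     = x - of_nat N * b * (\<Sum>k\<le>n. (-1) ^ k * of_nat (n choose k)
          * pochhammer (b + 1) k / pochhammer (x + 1) k / of_nat (Suc k))"
    using assms mult_left_cancel by blast
  then show ?thesis
    unfolding b1 N_def b_def by (simp add: algebra_simps)
qed

text \<open>The right-hand side of \<open>sum_geg_coeff_div_Suc_mult\<close> is 2x+n+1 for even n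
  and -(n+1) for odd n, so in each parity it cancels one of the two factors on the left.\<close>

lemma sum_geg_coeff_div_Suc:
  fixes x :: complex
  assumes "pochhammer (x + 1) (Suc n) \<noteq> 0"
  shows "(\<Sum>k\<le>n. (-1) ^ k * of_nat (n choose k) * pochhammer (2 * x + of_nat n + 2) k
                / pochhammer (x + 1) k / of_nat (Suc k))
       = (if even n then 1 / (of_nat n + 1) else - 1 / (2 * x + of_nat n + 1))"
proof -
  define D where "D = (\<lambda>x :: complex. \<Sum>k\<le>n. (-1) ^ k * of_nat (n choose k) * pochhammer (2 * x + of_nat n + 2) k
                / pochhammer (x + 1) k / of_nat (Suc k))"
  have nz: "pochhammer (x + 1) n \<noteq> 0"
    using assms by (auto simp: pochhammer_Suc)
  have N0: "of_nat (Suc n) \<noteq> (0::complex)" by (rule of_nat_neq_0)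
  have even_generic: "D y = 1 / (of_nat n + 1)"
    if "even n" "pochhammer (y + 1) n \<noteq> 0" "2 * y + of_nat n + 1 \<noteq> 0" for y
  proof -
    have "(2 * y + of_nat n + 1) * (of_nat (Suc n) * D y) = (2 * y + of_nat n + 1) * 1"
      using sum_geg_coeff_div_Suc_mult[OF that(2)] that(1) unfolding D_def by (simp add: algebra_simps)
    then have "of_nat (Suc n) * D y = 1"
      using that(3) mult_left_cancel by blast
    then show ?thesis
      using N0 by (simp add: field_simps)
  qed
  have "D x = (if even n then 1 / (of_nat n + 1) else - 1 / (2 * x + of_nat n + 1))"
  proof (cases "even n")
    case True
    \<comment> \<open>Here \<open>2x + n + 1\<close> may vanish, so the factor is cancelled near \<open>x\<close> and the value at \<open>x\<close> is
      obtained by continuity.\<close>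
    have cont_p: "isCont (\<lambda>y. pochhammer (c * y + d) k) x" for c d :: complex and k
      unfolding pochhammer_prod by (intro continuous_intros)
    have "isCont D x"
      unfolding D_def
    proof (intro continuous_intros)
      fix k assume "k \<in> {..n}"
      show "isCont (\<lambda>y. pochhammer (2 * y + of_nat n + 2) k) x"
        using cont_p[of 2 "of_nat n + 2" k] by (simp add: add_ac)
      show "isCont (\<lambda>y. pochhammer (y + 1) k) x"
        using cont_p[of 1 1 k] by simp
    qed (use pochhammer_split_nonzero(1)[OF nz] one_plus_of_nat_neq_0[where 'a=complex] in auto)
    then have lim: "(D \<longlongrightarrow> D x) (at x)"
      by (simp add: isCont_def)
    have "isCont (\<lambda>y. pochhammer (y + 1) n) x"
      using cont_p[of 1 1 n] by simp
    then have "\<forall>\<^sub>F y in at x. pochhammer (y + 1) n \<noteq> 0"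
      using nz unfolding isCont_def by (rule tendsto_imp_eventually_ne)
    moreover have "\<forall>\<^sub>F y in at x. y \<noteq> - (of_nat n + 1) / 2"
      by (rule eventually_neq_at_within)
    ultimately have "\<forall>\<^sub>F y in at x. D y = 1 / (of_nat n + 1)"
    proof eventually_elim
      case (elim y)
      from elim(2) have "2 * y + of_nat n + 1 \<noteq> 0"
        by (auto simp: field_simps) (metis add.commute add_eq_0_iff2 add.assoc)
      with elim(1) True show ?case by (intro even_generic)
    qed
    then have "(D \<longlongrightarrow> 1 / (of_nat n + 1)) (at x)"
      by (rule tendsto_eventually)
    with lim show ?thesis
      using True LIM_unique by auto
  next
    case False
    then obtain m where m: "n = 2 * m + 1" by (rule oddE)
    \<comment> \<open>For odd n, half of 2x+n+1 is x+m+1, which is a factor of (x+1)_n.\<close>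
    have "pochhammer (x + 1) (Suc m) \<noteq> 0"
      using pochhammer_split_nonzero(1)[OF nz] m by simp
    then have "x + 1 + of_nat m \<noteq> 0"
      by (auto simp: pochhammer_Suc)
    moreover have "2 * x + of_nat n + 1 = 2 * (x + 1 + of_nat m)"
      by (simp add: m algebra_simps)
    ultimately have b0: "2 * x + of_nat n + 1 \<noteq> 0"
      by (simp only: mult_eq_0_iff) simp
    have "of_nat (Suc n) * ((2 * x + of_nat n + 1) * D x) = of_nat (Suc n) * - 1"
      using sum_geg_coeff_div_Suc_mult[OF nz] False unfolding D_def by (simp add: algebra_simps)
    then have "(2 * x + of_nat n + 1) * D x = - 1"
      using N0 mult_left_cancel by blast
    then show ?thesis
      using b0 False by (simp add: field_simps)
  qed
  then show ?thesis by (simp add: D_def)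
qed

section \<open>Recurrence in n for the harmonic sum, and its solution\<close>

text \<open>With t marking k, the generating polynomial of f(n+1,k) + f(n,k) vanishes at t = 1 by
  \<open>sum_geg_coeff\<close>, so 1 - t divides it and its coefficients are differences. The
  quotient is twice the polynomial with coefficients \<open>g\<close>, a multiple of the Jacobi
  polynomial with parameters x and x+1.\<close>

lemma geg_coeff_step:
  assumes "pochhammer (x + 1) (Suc n) \<noteq> 0" "k \<le> n"
  defines "g \<equiv> \<lambda>k. (-1) ^ k * of_nat (n choose k) * pochhammer (2 * x + of_nat n + 2) k
                / pochhammer (x + 1) k"
  shows "geg_coeff x (Suc n) (Suc k) + geg_coeff x n (Suc k) = 2 * (g (Suc k) - g k)"
proof -
  have "pochhammer (x + 1) (Suc k) \<noteq> 0"
    using pochhammer_split_nonzero[OF assms(1), of "Suc k"] assms(2) by simp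
  then have nz: "pochhammer (x + 1) k \<noteq> 0" "x + 1 + of_nat k \<noteq> 0"
    by (auto simp: pochhammer_Suc)
  define B where "B = (of_nat (n choose k) :: complex)"
  have B': "of_nat (Suc n choose Suc k) = B + (of_nat n - of_nat k) * B / (1 + of_nat k)"
    by (simp add: of_nat_choose_Suc B_def)
  have a1: "2 * x + of_nat (Suc n) + 1 = 2 * x + of_nat n + 2"
    by simp
  have a2: "pochhammer (2 * x + of_nat n + 1) (Suc k)
      = (2 * x + of_nat n + 1) * pochhammer (2 * x + of_nat n + 2) k"
    by (simp add: pochhammer_rec add_ac)
  show ?thesis
    using nz one_plus_of_nat_neq_0[of k, where 'a=complex]
    unfolding geg_coeff_def g_def B' a1 a2 unfolding of_nat_choose_Suc pochhammer_Suc power_Suc B_def[symmetric]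
    by (simp add: divide_simps) algebra
qed

abbreviation (input) harm_at :: "nat \<Rightarrow> complex \<Rightarrow> complex" where
  "harm_at j y \<equiv> shifted_harm (int j) y"

lemma harm_at_0 [simp]: "shifted_harm 0 y = 0"
  by (simp add: shifted_harm_def)

lemma harm_at_Suc: "harm_at (Suc j) y = harm_at j y + 1 / (y + of_nat (Suc j))"
  by (simp add: shifted_harm_def nat_add_distrib)

lemma sum_diff_times_harm:
  "(\<Sum>k\<le>N. (g (Suc k) - g k) * harm_at (Suc k) 0)
     = g (Suc N) * harm_at (Suc N) 0 - (\<Sum>k\<le>N. g k / of_nat (Suc k))"
proof (induction N)
  case (Suc N)
  then show ?case
    by (simp only: sum.atMost_Suc harm_at_Suc[of "Suc N"]) (simp add: algebra_simps add_divide_distrib diff_divide_distrib)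
qed (use harm_at_Suc[of 0 0] in \<open>simp add: algebra_simps\<close>)

lemma sum_geg_coeff_harm_step:
  assumes "pochhammer (x + 1) (Suc n) \<noteq> 0"
  shows "(\<Sum>k\<le>Suc n. geg_coeff x (Suc n) k * harm_at k 0) + (\<Sum>k\<le>n. geg_coeff x n k * harm_at k 0)
       = (if even n then - 2 / (of_nat n + 1) else 2 / (2 * x + of_nat n + 1))"
proof -
  define g where "g = (\<lambda>k. (-1) ^ k * of_nat (n choose k) * pochhammer (2 * x + of_nat n + 2) k
                / pochhammer (x + 1) k)"
  have "(\<Sum>k\<le>Suc n. geg_coeff x (Suc n) k * harm_at k 0) + (\<Sum>k\<le>n. geg_coeff x n k * harm_at k 0)
      = (\<Sum>k\<le>Suc n. (geg_coeff x (Suc n) k + geg_coeff x n k) * harm_at k 0)"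
    by (simp add: sum.distrib distrib_right)
  \<comment> \<open>The term k = 0, which is not covered by \<open>geg_coeff_step\<close>, drops out
    because H_0 = 0.\<close>
  also have "\<dots> = (\<Sum>k\<le>n. (geg_coeff x (Suc n) (Suc k) + geg_coeff x n (Suc k)) * harm_at (Suc k) 0)"
    by (subst sum.atMost_Suc_shift) simp
  also have "\<dots> = 2 * (\<Sum>k\<le>n. (g (Suc k) - g k) * harm_at (Suc k) 0)"
    unfolding sum_distrib_left
    by (intro sum.cong refl) (simp only: geg_coeff_step[OF assms] atMost_iff g_def mult.assoc)
  \<comment> \<open>The upper boundary term vanishes since \<open>n choose Suc n\<close> is
    zero.\<close>
  also have "\<dots> = - 2 * (\<Sum>k\<le>n. g k / of_nat (Suc k))"
    unfolding sum_diff_times_harm by (simp add: g_def)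
  also have "\<dots> = (if even n then - 2 / (of_nat n + 1) else 2 / (2 * x + of_nat n + 1))"
    unfolding g_def sum_geg_coeff_div_Suc[OF assms] by simp
  finally show ?thesis .
qed

text \<open>Induction through the recurrence. From even n only 2 H_n changes, by 2/(n+1). From odd n
  = 2m+1 its increment 1/(m+1) cancels against that of H_m, leaving 1/(x+m+1) = 2/(2x+n+1) from
  H_m(x).\<close>

lemma sum_geg_coeff_harm:
  assumes "pochhammer (x + 1) n \<noteq> 0"
  shows "(\<Sum>k\<le>n. geg_coeff x n k * harm_at k 0)
       = (-1) ^ n * (2 * harm_at n 0 - harm_at (n div 2) 0 + harm_at (n div 2) x)"
  using assms
proof (induction n)
  case (Suc n)
  have nz: "pochhammer (x + 1) n \<noteq> 0"
    using Suc.prems by (auto simp: pochhammer_Suc)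
  have eq: "(\<Sum>k\<le>Suc n. geg_coeff x (Suc n) k * harm_at k 0)
      = (if even n then - 2 / (of_nat n + 1) else 2 / (2 * x + of_nat n + 1))
        - (-1) ^ n * (2 * harm_at n 0 - harm_at (n div 2) 0 + harm_at (n div 2) x)"
    using sum_geg_coeff_harm_step[OF Suc.prems] unfolding Suc.IH[OF nz] by (simp only: eq_diff_eq)
  show ?case
  proof (cases "even n")
    case True
    then have "Suc n div 2 = n div 2" by simp
    with True show ?thesis
      unfolding eq harm_at_Suc[of n] by (simp add: add_ac)
  next
    case False
    then obtain m where m: "n = 2 * m + 1" by (rule oddE)
    then have d: "Suc n div 2 = Suc m" "n div 2 = m" by auto
    have e: "2 * x + of_nat n + 1 = 2 * (x + of_nat (Suc m))" "of_nat (Suc n) = 2 * (of_nat (Suc m) :: complex)"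
      by (simp_all add: m algebra_simps)
    \<comment> \<open>The zeros in the denominators are the argument y = 0 left by unfolding
      \<open>harm_at_Suc\<close>.\<close>
    have q: "2 / (2 * c) = 1 / c" "2 * (1 / (0 + 2 * c)) = 1 / (0 + c)" for c :: complex
      by simp_all
    show ?thesis
      using False unfolding eq d harm_at_Suc[of n] harm_at_Suc[of m] e q
      unfolding distrib_left[of 2] q by (simp del: of_nat_Suc)
  qed
qed simp

section \<open>Moments with and without harmonic numbers\<close>

text \<open>The shift identity with \<open>\<phi>\<close> equal to 1 and to k. Since (k-n)(k+2x+n+1)
  = k^2 + (2x+1)k - P, the leading powers of k cancel between its two sides.\<close>

lemma sum_geg_coeff_moments:
  assumes "pochhammer (x + 1) n \<noteq> 0"
  defines "P \<equiv> of_nat n * (2 * x + of_nat n + 1)"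
  defines "M \<equiv> \<lambda>i. \<Sum>k\<le>n. of_nat k ^ i * geg_coeff x n k"
  shows "(x + 1) * M 1 = P * M 0"
    and "(x + 2) * M 2 = (P - 2 * x - 1) * M 1 + P * M 0"
proof -
  note shift = sum_geg_coeff_shift[OF assms(1)]
  let ?f = "geg_coeff x n"
  have "(x + 1) * M 1 - P * M 0
      = (\<Sum>k\<le>n. of_nat k * (of_nat k + x) * ?f k * 1
          - (of_nat k - of_nat n) * (of_nat k + 2 * x + of_nat n + 1) * ?f k * 1) * (- 1)"
    unfolding M_def sum_distrib_left sum_distrib_right sum_subtractf[symmetric]
    by (intro sum.cong refl) (simp add: P_def algebra_simps)
  also have "\<dots> = 0"
    unfolding sum_subtractf using shift[of "\<lambda>k. 1"] by simp
  finally show "(x + 1) * M 1 = P * M 0" by simp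
  have "(x + 2) * M 2 - (P - 2 * x - 1) * M 1 - P * M 0
      = (\<Sum>k\<le>n. of_nat k * (of_nat k + x) * ?f k * of_nat k
          - (of_nat k - of_nat n) * (of_nat k + 2 * x + of_nat n + 1) * ?f k * of_nat (Suc k)) * (- 1)"
    unfolding M_def sum_distrib_left sum_distrib_right sum_subtractf[symmetric]
    by (intro sum.cong refl) (simp add: P_def algebra_simps power2_eq_square)
  also have "\<dots> = 0"
    unfolding sum_subtractf using shift[of of_nat] by simp
  finally show "(x + 2) * M 2 = (P - 2 * x - 1) * M 1 + P * M 0"
    by (simp add: algebra_simps)
qed

text \<open>The same cancellation with \<open>\<phi>\<close> equal to H_k and k H_k. Passing from k
  to k+1 leaves the extra summands 1/(k+1) and 1 respectively, which account for the terms in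
  \<open>M\<close>.\<close>

lemma sum_geg_coeff_harm_moments:
  assumes "pochhammer (x + 1) n \<noteq> 0"
  defines "P \<equiv> of_nat n * (2 * x + of_nat n + 1)"
  defines "M \<equiv> \<lambda>i. \<Sum>k\<le>n. of_nat k ^ i * geg_coeff x n k"
  defines "A \<equiv> \<lambda>i. \<Sum>k\<le>n. of_nat k ^ i * geg_coeff x n k * harm_at k 0"
  shows "(x + 1) * A 1 = P * A 0 - M 1 - x * M 0 + x"
    and "(x + 2) * A 2 = (P - 2 * x - 1) * A 1 + P * A 0 - M 2 - (2 * x + 1) * M 1 + P * M 0"
proof -
  note shift = sum_geg_coeff_shift[OF assms(1)]
  let ?f = "geg_coeff x n"
  let ?H = "\<lambda>k. harm_at k 0"
  let ?Q = "\<lambda>k. (of_nat k - of_nat n) * (of_nat k + 2 * x + of_nat n + 1) * ?f k"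
  \<comment> \<open>The shift is read backwards with \<open>\<phi>\<close> k = 1/k. At k = 0 the
    left summand is 0, while k + x times the coefficient is x there; hence the correction by
    x.\<close>
  have "(\<Sum>k\<le>n. ?Q k * (1 / of_nat (Suc k))) = (\<Sum>k\<le>n. of_nat k * (of_nat k + x) * ?f k * (1 / of_nat k))"
    by (rule shift[symmetric])
  also have "\<dots> = (\<Sum>k\<le>n. of_nat k * ?f k + x * ?f k - (if k = 0 then x else 0))"
    by (intro sum.cong refl) (auto simp: algebra_simps)
  also have "\<dots> = M 1 + x * M 0 - x"
    unfolding M_def sum_distrib_left sum_subtractf sum.distrib by simp
  finally have inv: "(\<Sum>k\<le>n. ?Q k * (1 / of_nat (Suc k))) = M 1 + x * M 0 - x" .
  have shift_H: "(\<Sum>k\<le>n. of_nat k * (of_nat k + x) * ?f k * ?H k)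
      = (\<Sum>k\<le>n. ?Q k * ?H k) + (\<Sum>k\<le>n. ?Q k * (1 / of_nat (Suc k)))"
    unfolding shift[of ?H] harm_at_Suc sum.distrib[symmetric]
    by (intro sum.cong refl) (simp add: distrib_left)
  have "(x + 1) * A 1 - P * A 0
      = (\<Sum>k\<le>n. of_nat k * (of_nat k + x) * ?f k * ?H k - ?Q k * ?H k) * (- 1)"
    unfolding A_def sum_distrib_left sum_distrib_right sum_subtractf[symmetric]
    by (intro sum.cong refl) (simp add: P_def algebra_simps)
  also have "\<dots> = - (\<Sum>k\<le>n. ?Q k * (1 / of_nat (Suc k)))"
    unfolding sum_subtractf shift_H by simp
  finally show "(x + 1) * A 1 = P * A 0 - M 1 - x * M 0 + x"
    unfolding inv by (simp add: algebra_simps)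
  have "of_nat (Suc k) * ?H (Suc k) = of_nat (Suc k) * ?H k + 1" for k
    using one_plus_of_nat_neq_0[of k, where 'a=complex] unfolding harm_at_Suc
    by (simp add: distrib_left)
  then have shift_kH: "(\<Sum>k\<le>n. of_nat k * (of_nat k + x) * ?f k * (of_nat k * ?H k))
      = (\<Sum>k\<le>n. ?Q k * (of_nat (Suc k) * ?H k)) + (\<Sum>k\<le>n. ?Q k)"
    unfolding shift[of "\<lambda>k. of_nat k * ?H k"] sum.distrib[symmetric]
    by (intro sum.cong refl) (simp only: distrib_left mult_1_right)
  have "(x + 2) * A 2 - (P - 2 * x - 1) * A 1 - P * A 0
      = (\<Sum>k\<le>n. of_nat k * (of_nat k + x) * ?f k * (of_nat k * ?H k) - ?Q k * (of_nat (Suc k) * ?H k)) * (- 1)"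
    unfolding A_def sum_distrib_left sum_distrib_right sum_subtractf[symmetric]
    by (intro sum.cong refl) (simp add: P_def algebra_simps power2_eq_square)
  also have "\<dots> = - (\<Sum>k\<le>n. ?Q k)"
    unfolding sum_subtractf shift_kH by simp
  also have "(\<Sum>k\<le>n. ?Q k) = M 2 + (2 * x + 1) * M 1 - P * M 0"
    unfolding M_def sum_distrib_left sum.distrib[symmetric] sum_subtractf[symmetric]
    by (intro sum.cong refl) (simp add: P_def algebra_simps power2_eq_square)
  finally show "(x + 2) * A 2 = (P - 2 * x - 1) * A 1 + P * A 0 - M 2 - (2 * x + 1) * M 1 + P * M 0"
    by (simp add: algebra_simps)
qed

section \<open>Elimination and the closed form\<close>

text \<open>Eliminates the first moments from the relations above. The factor P - x arises as
  (P-2x-1) + (x+1) and equals n^2+n+2nx-x; the summand with 1 - (-1)^n stems from the correction at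
  k = 0.\<close>

lemma sum_sq_geg_coeff_harm:
  assumes "pochhammer (x + 1) n \<noteq> 0" and nz: "x + 1 \<noteq> 0" "x + 2 \<noteq> 0"
  defines "P \<equiv> of_nat n * (2 * x + of_nat n + 1)"
  shows "(x + 1) * (x + 2) * (\<Sum>k\<le>n. of_nat k ^ 2 * geg_coeff x n k * harm_at k 0)
       = P * (P - x) * (\<Sum>k\<le>n. geg_coeff x n k * harm_at k 0)
         + (1 - (-1) ^ n) * x * (P - 2 * x - 1)
         + (-1) ^ n * P * (1 - x - (P - x) / (x + 1) - (P - x) / (x + 2))"
proof -
  define M where "M = (\<lambda>i. \<Sum>k\<le>n. of_nat k ^ i * geg_coeff x n k)"
  define A where "A = (\<lambda>i. \<Sum>k\<le>n. of_nat k ^ i * geg_coeff x n k * harm_at k 0)"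
  define \<epsilon> where "\<epsilon> = (-1 :: complex) ^ n"
  have M0: "M 0 = \<epsilon>"
    using sum_geg_coeff[OF assms(1)] by (simp add: M_def \<epsilon>_def)
  have M1: "M 1 = P * \<epsilon> / (x + 1)"
    using sum_geg_coeff_moments(1)[OF assms(1)] nz unfolding M0[symmetric] M_def P_def
    by (simp add: nonzero_eq_divide_eq mult.commute)
  have M2: "(x + 1) * M 2 = P * (P - x) * \<epsilon> / (x + 2)"
  proof -
    have "(x + 2) * M 2 = (P - 2 * x - 1) * M 1 + P * M 0"
      unfolding M_def P_def by (rule sum_geg_coeff_moments(2)[OF assms(1)])
    then have "(x + 2) * ((x + 1) * M 2) = (P - 2 * x - 1) * ((x + 1) * M 1) + (x + 1) * (P * M 0)"
      by algebra
    also have "(x + 1) * M 1 = P * \<epsilon>"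
      unfolding M1 using nz by simp
    finally have "(x + 2) * ((x + 1) * M 2) = P * (P - x) * \<epsilon>"
      unfolding M0 by algebra
    then show ?thesis
      using nz by (simp add: nonzero_eq_divide_eq mult_ac)
  qed
  have A1: "(x + 1) * A 1 = P * A 0 - M 1 - x * \<epsilon> + x"
    and A2: "(x + 2) * A 2 = (P - 2 * x - 1) * A 1 + P * A 0 - M 2 - (2 * x + 1) * M 1 + P * \<epsilon>"
    unfolding M0[symmetric] A_def M_def P_def by (rule sum_geg_coeff_harm_moments[OF assms(1)])+
  have "(x + 1) * (x + 2) * A 2
      = (P - 2 * x - 1) * ((x + 1) * A 1) + (x + 1) * P * A 0 - (x + 1) * M 2
        - (2 * x + 1) * ((x + 1) * M 1) + (x + 1) * P * \<epsilon>"
    using A2 by algebra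
  also have "\<dots> = P * (P - x) * A 0 + (1 - \<epsilon>) * x * (P - 2 * x - 1)
         + \<epsilon> * P * (1 - x - (P - x) / (x + 1) - (P - x) / (x + 2))"
    unfolding A1 M1 M2 using nz by (simp add: divide_simps) algebra
  finally show ?thesis
    by (simp add: A_def \<epsilon>_def)
qed

text \<open>H_(m-2)(x+2) is H_m(x) without its first two terms. The convention for negative indices
  is what extends this to m = 0 and m = 1, so the small cases are treated separately.\<close>

lemma shifted_harm_shift_2:
  assumes "x + 1 \<noteq> 0" "x + 2 \<noteq> 0"
  shows "shifted_harm (int m - 2) (x + 2) = harm_at m x - 1 / (x + 1) - 1 / (x + 2)"
proof (induction m)
  case 0
  show ?case
    by (simp add: shifted_harm_def numeral_2_eq_2 algebra_simps)
next
  case (Suc m)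
  show ?case
  proof (cases m)
    case 0
    then show ?thesis by (simp add: shifted_harm_def)
  next
    case [simp]: (Suc l)
    show ?thesis
    proof (cases l)
      case 0
      then show ?thesis by (simp add: shifted_harm_def numeral_2_eq_2 atLeastAtMostSuc_conv)
    next
      case (Suc j)
      then show ?thesis using Suc.IH
        using harm_at_Suc[of j "x + 2"] harm_at_Suc[of m x] by (simp add: add_ac)
    qed
  qed
qed

theorem theorem3:
  fixes x :: complex and n :: nat
  assumes binom_defined: "\<And>k. k \<le> n \<Longrightarrow> (x + of_nat k) gchoose k \<noteq> 0"
    and prefactor_defined: "(x + 1) * (x + 2) \<noteq> 0"
    and even_defined: "\<And>m. n = 2 * m \<Longrightarrow>
          shifted_harm_defined (int m - 2) (x + 2) \<and>
          2 * of_nat m * (2 * x + 2 * of_nat m + 1) - x \<noteq> 0"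
    and odd_defined: "\<And>m. n = 2 * m + 1 \<Longrightarrow>
          shifted_harm_defined (int m - 1) (x + 2) \<and>
          2 * of_nat m * (2 * x + 2 * of_nat m + 3) + x + 2 \<noteq> 0"
  shows "(\<Sum>k=0..n. (-1) ^ k * of_nat (n choose k)
            * (((2 * x + of_nat n + of_nat k) gchoose k) / ((x + of_nat k) gchoose k))
            * of_nat k ^ 2 * shifted_harm (int k) 0)
       = of_nat n * (2 * x + of_nat n + 1)
            * (of_nat n ^ 2 + of_nat n + 2 * of_nat n * x - x) / ((x + 1) * (x + 2))
         * (let m = n div 2 in
            if even n then
              2 * shifted_harm (int (2 * m)) 0 - shifted_harm (int m) 0
                + shifted_harm (int m - 2) (x + 2)
                + (1 - x) / (2 * of_nat m * (2 * x + 2 * of_nat m + 1) - x)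
            else
              shifted_harm (int m) 0 - 2 * shifted_harm (int (2 * m)) 0
                - shifted_harm (int m - 1) (x + 2)
                - (x + 3) / (2 * of_nat m * (2 * x + 2 * of_nat m + 3) + x + 2))"
proof -
  have nz: "pochhammer (x + 1) n \<noteq> 0" "x + 1 \<noteq> 0" "x + 2 \<noteq> 0"
    using binom_defined[of n] prefactor_defined by (auto simp: gbinomial_pochhammer')
  define P where "P = of_nat n * (2 * x + of_nat n + 1)"
  define S where "S = (\<Sum>k\<le>n. of_nat k ^ 2 * geg_coeff x n k * harm_at k 0)"
  define A where "A = (\<Sum>k\<le>n. geg_coeff x n k * harm_at k 0)"
  define m where "m = n div 2"
  define R where "R = (if even n then
              2 * shifted_harm (int (2 * m)) 0 - shifted_harm (int m) 0
                + shifted_harm (int m - 2) (x + 2)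
                + (1 - x) / (2 * of_nat m * (2 * x + 2 * of_nat m + 1) - x)
            else
              shifted_harm (int m) 0 - 2 * shifted_harm (int (2 * m)) 0
                - shifted_harm (int m - 1) (x + 2)
                - (x + 3) / (2 * of_nat m * (2 * x + 2 * of_nat m + 3) + x + 2))"
  have S: "(x + 1) * (x + 2) * S = P * (P - x) * A
         + (1 - (-1) ^ n) * x * (P - 2 * x - 1)
         + (-1) ^ n * P * (1 - x - (P - x) / (x + 1) - (P - x) / (x + 2))"
    unfolding S_def A_def P_def by (rule sum_sq_geg_coeff_harm[OF nz])
  have A: "A = (-1) ^ n * (2 * harm_at n 0 - harm_at m 0 + harm_at m x)"
    unfolding A_def m_def by (rule sum_geg_coeff_harm[OF nz(1)])
  have "(x + 1) * (x + 2) * S = P * (P - x) * R"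
  proof (cases "even n")
    case True
    then have n: "n = 2 * m" by (simp add: m_def)
    \<comment> \<open>The last denominator is exactly the prefactor's P - x, so that fraction
      contributes just P(1-x).\<close>
    have d: "2 * of_nat m * (2 * x + 2 * of_nat m + 1) - x = P - x"
      by (simp add: P_def n algebra_simps)
    have "P - x \<noteq> 0"
      using even_defined[OF n] d by simp
    then have "P * (P - x) * R = P * (P - x) * (2 * harm_at n 0 - harm_at m 0 + harm_at m x
          - 1 / (x + 1) - 1 / (x + 2)) + P * (1 - x)"
      using True unfolding R_def d shifted_harm_shift_2[OF nz(2,3)] n[symmetric]
      by (simp add: field_simps)
    then show ?thesis
      using True unfolding S A by (simp add: algebra_simps diff_divide_distrib)
  next
    case False
    then have n: "n = 2 * m + 1" by (simp add: m_def)
    have "pochhammer (x + 1) (Suc m) \<noteq> 0"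
      using pochhammer_split_nonzero(1)[OF nz(1)] n by simp
    then have b0: "x + of_nat (Suc m) \<noteq> 0"
      by (auto simp: pochhammer_Suc add_ac)
    have a0: "of_nat n \<noteq> (0 :: complex)"
      using n by (simp only: of_nat_eq_0_iff)
    have d: "2 * of_nat m * (2 * x + 2 * of_nat m + 3) + x + 2 = P - x"
      by (simp add: P_def n algebra_simps)
    have "P - x \<noteq> 0"
      using odd_defined[OF n] d by simp
    then have cancel: "P * (P - x) * ((x + 3) / (P - x)) = P * (x + 3)"
      by simp
    have Hx: "shifted_harm (int m - 1) (x + 2)
        = harm_at m x + 1 / (x + of_nat (Suc m)) - 1 / (x + 1) - 1 / (x + 2)"
      using shifted_harm_shift_2[OF nz(2,3), of "Suc m"] harm_at_Suc[of m x] by simp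
    have R: "P * (P - x) * R = P * (P - x) * (harm_at m 0 - 2 * harm_at (2 * m) 0
          - (harm_at m x + 1 / (x + of_nat (Suc m)) - 1 / (x + 1) - 1 / (x + 2))) - P * (x + 3)"
      using False unfolding R_def d Hx cancel[symmetric]
      by (simp only: if_False right_diff_distrib)
    have H: "harm_at n 0 = harm_at (2 * m) 0 + 1 / of_nat n"
      using harm_at_Suc[of "2 * m" 0] by (simp add: n)
    have P2: "P = 2 * of_nat n * (x + of_nat (Suc m))"
      by (simp add: P_def n algebra_simps)
    \<comment> \<open>What remains once the harmonic numbers match: 1/n separates H_n from H_(2m),
      and 1/(x+m+1) separates H_(m+1)(x) from H_m(x). By \<open>P2\<close> both denominators divide
      P, leaving a polynomial identity.\<close>
    have "- 2 * (P * (P - x) / of_nat n) + 2 * x * (P - 2 * x - 1) - P * (1 - x)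
        = - (P * (P - x) / (x + of_nat (Suc m))) - P * (x + 3)"
    proof -
      have q: "P * (P - x) / of_nat n = 2 * (x + of_nat (Suc m)) * (P - x)"
        "P * (P - x) / (x + of_nat (Suc m)) = 2 * of_nat n * (P - x)"
        using nonzero_mult_div_cancel_left[OF a0, of "2 * (x + of_nat (Suc m)) * (P - x)"]
          nonzero_mult_div_cancel_left[OF b0, of "2 * of_nat n * (P - x)"]
        by (simp_all only: P2 mult_ac)
      have "of_nat n = 2 * of_nat (Suc m) - (1 :: complex)"
        by (simp add: n)
      then show ?thesis
        unfolding q by algebra
    qed
    then show ?thesis
      using False unfolding S A R H by (simp add: algebra_simps diff_divide_distrib)
  qed
  then have "S = P * (P - x) / ((x + 1) * (x + 2)) * R"
    using nz by (simp add: nonzero_eq_divide_eq mult_ac)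
  moreover have "S = (\<Sum>k=0..n. (-1) ^ k * of_nat (n choose k)
            * (((2 * x + of_nat n + of_nat k) gchoose k) / ((x + of_nat k) gchoose k))
            * of_nat k ^ 2 * shifted_harm (int k) 0)"
    unfolding S_def atMost_atLeast0
    by (intro sum.cong refl) (simp add: geg_coeff_def gbinomial_pochhammer')
  moreover have "P * (P - x) = of_nat n * (2 * x + of_nat n + 1)
            * (of_nat n ^ 2 + of_nat n + 2 * of_nat n * x - x)"
    by (simp add: P_def algebra_simps power2_eq_square)
  ultimately show ?thesis
    unfolding R_def Let_def m_def by simp
qed

end
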